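(* Let $k$ and $g$ satisfy the general conditions (GC). Then there is a nontrivial solution of the nonlinear Volterra integral equation $$u(x)=\int_0^x k(x,s)\,g(u(s))\,ds$$ if and only if this equation admits a nontrivial subsolution.
   Context: General conditions (GC) on a pair $(k,g)$: - (K1) The kernel $k:\mathbb{R}^2\to[0,\infty)$ is a locally bounded function such that $k(x,s)=0$ whenever $s>x$. - (K2) For every $x\in\mathbb{R}$ the map $s\mapsto k(x,s)$ is locally integrable, and $K(x)=\int_0^x k(x,s)\,ds$ is a strictly increasing function (of $x\ge 0$). - (G1) The nonlinearity $g$ is a continuous real function, vanishing on $(-\infty,0]$, strictly increasing (on $[0,\infty)$), and such that $g'>0$ almost everywhere (on $(0,\infty)$). Write $T_{kg}f(x)=\int_0^x k(x,s)\,g(f(s))\,ds$. A solution is a fixed point of $T_{kg}$, i.e. a function $u$ with $u=T_{kg}u$; a subsolution is a function $v$ with $v\le T_{kg}v$. Since $g(0)=0$, the zero function is always a solution, called the trivial solution; nontrivial means different from the zero function. All functions considered are assumed bounded near zero, i.e. bounded on some interval $[0,\delta]$ with $\delta>0$.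
   Formalization: The kernel is also assumed jointly Lebesgue measurable; solutions and subsolutions are measurable, nonnegative, bounded functions on some interval [0,δ], nontrivial there, with δ possibly different for the two. Negative constants, blow-up and nonmeasurable kernels refute the literal claim. *)

theory Defs
  imports "HOL-Analysis.Analysis"
begin

text \<open>Joint Lebesgue measurability of the kernel, without which \<open>volterra_op k g f\<close>
  need not be a measurable function, is part of the meaning of ``kernel'' here.\<close>

definition volterra_kernel :: "(real \<Rightarrow> real \<Rightarrow> real) \<Rightarrow> bool" where
  "volterra_kernel k \<longleftrightarrow>
     (\<lambda>(x, s). k x s) \<in> borel_measurable lebesgue \<and>
     (\<forall>x s. 0 \<le> k x s) \<and>
     (\<forall>C. compact C \<longrightarrow> bounded ((\<lambda>(x, s). k x s) ` C)) \<and>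
     (\<forall>x s. x < s \<longrightarrow> k x s = 0) \<and>
     (\<forall>x a b. set_integrable lebesgue {a..b} (k x)) \<and>
     strict_mono_on {0..} (\<lambda>x. LINT s:{0..x}|lebesgue. k x s)"

definition volterra_nonlinearity :: "(real \<Rightarrow> real) \<Rightarrow> bool" where
  "volterra_nonlinearity g \<longleftrightarrow>
     continuous_on UNIV g \<and>
     (\<forall>y\<le>0. g y = 0) \<and>
     strict_mono_on {0..} g \<and>
     (AE y in lebesgue. 0 < y \<longrightarrow> (\<exists>D>0. (g has_real_derivative D) (at y)))"

definition general_conditions :: "(real \<Rightarrow> real \<Rightarrow> real) \<Rightarrow> (real \<Rightarrow> real) \<Rightarrow> bool" where
  "general_conditions k g \<longleftrightarrow> volterra_kernel k \<and> volterra_nonlinearity g"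

definition volterra_op ::
  "(real \<Rightarrow> real \<Rightarrow> real) \<Rightarrow> (real \<Rightarrow> real) \<Rightarrow> (real \<Rightarrow> real) \<Rightarrow> real \<Rightarrow> real" where
  "volterra_op k g f x = (LINT s:{0..x}|lebesgue. k x s * g (f s))"

text \<open>Solutions are local: they live on some interval \<open>[0, \<delta>]\<close> on which they are bounded,
  and may fail to extend to the half-line because of blow-up. Nonnegativity is automatic for
  fixed points of \<open>volterra_op k g\<close>, but not for subsolutions: negative constants always satisfy
  \<open>v \<le> volterra_op k g v\<close> on \<open>[0, \<delta>]\<close>.\<close>

definition admissible_on :: "real \<Rightarrow> (real \<Rightarrow> real) \<Rightarrow> bool" where
  "admissible_on \<delta> f \<longleftrightarrow>
     f \<in> borel_measurable (lebesgue_on {0..\<delta>}) \<and>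
     bounded (f ` {0..\<delta>}) \<and>
     (\<forall>x\<in>{0..\<delta>}. 0 \<le> f x)"

definition solution_on ::
  "(real \<Rightarrow> real \<Rightarrow> real) \<Rightarrow> (real \<Rightarrow> real) \<Rightarrow> real \<Rightarrow> (real \<Rightarrow> real) \<Rightarrow> bool" where
  "solution_on k g \<delta> u \<longleftrightarrow>
     admissible_on \<delta> u \<and> (\<forall>x\<in>{0..\<delta>}. u x = volterra_op k g u x)"

definition subsolution_on ::
  "(real \<Rightarrow> real \<Rightarrow> real) \<Rightarrow> (real \<Rightarrow> real) \<Rightarrow> real \<Rightarrow> (real \<Rightarrow> real) \<Rightarrow> bool" where
  "subsolution_on k g \<delta> v \<longleftrightarrow>
     admissible_on \<delta> v \<and> (\<forall>x\<in>{0..\<delta>}. v x \<le> volterra_op k g v x)"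

definition nontrivial_on :: "real \<Rightarrow> (real \<Rightarrow> real) \<Rightarrow> bool" where
  "nontrivial_on \<delta> f \<longleftrightarrow> (\<exists>x\<in>{0..\<delta>}. f x \<noteq> 0)"

end

theory Submission imports Defs begin

text \<open>
  A solution is in particular a subsolution, so the content is to produce a solution above a given
  nontrivial subsolution \<open>v\<close>. The operator \<open>volterra_op k g\<close> is monotone and passes to
  bounded pointwise limits, so its iterates started at \<open>v\<close> increase, and they converge to a
  solution above \<open>v\<close> as soon as some supersolution above \<open>v\<close> keeps them bounded
  (\<open>solution_between_sub_and_supersolution\<close>).

  In general supersolutions are available on short intervals only: at \<open>x\<close> the operator
  maps the constant \<open>M > 0\<close> to at most \<open>C * g M * x\<close>, where \<open>C\<close> bounds the
  kernel locally, and this is at most \<open>M\<close> for small \<open>x\<close>.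
  But \<open>v\<close> may vanish on an initial interval and become positive only
  beyond the range where this constant works. Let therefore \<open>a\<close> be the largest number such that \<open>v\<close> vanishes on \<open>[0, a]\<close>. A function that vanishes up to \<open>a\<close>
  enters the integral only through its values after \<open>a\<close>, because \<open>g 0 = 0\<close>, so the
  short interval may be taken just after \<open>a\<close>: the function that is
  \<open>0\<close> on \<open>[0, a]\<close> and \<open>M\<close> afterwards is a supersolution on
  \<open>[0, a + h]\<close> for small \<open>h\<close> (\<open>step_function_is_supersolution\<close>). With
  \<open>M\<close> an upper bound of \<open>v\<close> it lies above \<open>v\<close>, and \<open>v\<close> is not zero on
  \<open>[0, a + h]\<close> by the choice of \<open>a\<close>.

  The measure-theoretic point is that the iterates stay measurable. The kernel is Lebesgue
  measurable in the plane, where the theorems on iterated integrals need Borel measurability, so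
  kernel and argument are first replaced by Borel functions equal to them almost everywhere.
\<close>

section \<open>The nonlinearity and admissible functions\<close>

lemma nonlinearity_mono:
  assumes "volterra_nonlinearity g"
  shows "mono g"
proof (rule monoI)
  fix x y :: real assume xy: "x \<le> y"
  have neg: "g y = 0" if "y \<le> 0" for y
    using assms that by (auto simp: volterra_nonlinearity_def)
  have pos: "g x \<le> g y" if "0 \<le> x" "x \<le> y" for x y
    using assms strict_mono_on_leD[of "{0..}" g x y] that by (auto simp: volterra_nonlinearity_def)
  show "g x \<le> g y"
    using neg[of x] neg[of y] neg[of 0] pos[of x y] pos[of 0 y] xy
    by (cases "x \<le> 0"; cases "y \<le> 0") auto
qed

lemma nonlinearity_at_0:
  assumes "volterra_nonlinearity g"
  shows "g 0 = 0"
  using assms by (auto simp: volterra_nonlinearity_def)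

lemma nonlinearity_nonneg:
  assumes "volterra_nonlinearity g"
  shows "0 \<le> g y"
proof -
  have "g (min 0 y) \<le> g y"
    by (rule monoD[OF nonlinearity_mono[OF assms]]) simp
  moreover have "g (min 0 y) = 0"
    using assms by (auto simp: volterra_nonlinearity_def)
  ultimately show ?thesis by simp
qed

lemma nonlinearity_measurable:
  assumes "volterra_nonlinearity g"
  shows "g \<in> borel_measurable borel"
  using assms by (auto simp: volterra_nonlinearity_def intro: borel_measurable_continuous_onI)

lemma admissible_on_bounded_above:
  assumes "admissible_on d f"
  obtains B where "0 < B" and "\<And>s. s \<in> {0..d} \<Longrightarrow> f s \<le> B"
proof -
  obtain B where "0 < B" and B: "\<forall>y\<in>f ` {0..d}. norm y \<le> B"
    using assms unfolding admissible_on_def bounded_pos by blast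
  have "f s \<le> B" if "s \<in> {0..d}" for s
    using bspec[OF B imageI[OF that]] by simp
  with \<open>0 < B\<close> show ?thesis by (rule that)
qed

section \<open>Measurability of the Volterra operator\<close>

text \<open>For exceptional \<open>x\<close> the section \<open>k x\<close> may differ from the section of the
  Borel representative on a set of positive measure. These \<open>x\<close> form a null set, by Fubini's
  theorem, and changing the integral there does no harm to Lebesgue measurability.\<close>

lemma borel_measurable_lebesgue_kernel_integral:
  fixes k :: "real \<Rightarrow> real \<Rightarrow> real" and h :: "real \<Rightarrow> real"
  assumes k: "(\<lambda>(x, s). k x s) \<in> borel_measurable lebesgue"
    and h: "h \<in> borel_measurable lebesgue"
  shows "(\<lambda>x. LINT s:{0..x}|lebesgue. k x s * h s) \<in> borel_measurable lebesgue"
proof -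
  obtain k' where k'[measurable]: "k' \<in> borel_measurable lborel"
      and kk': "AE z in lborel. (case z of (x, s) \<Rightarrow> k x s) = k' z"
    using completion_ex_borel_measurable_real[OF k] by auto
  obtain h' where h'[measurable]: "h' \<in> borel_measurable lborel"
      and hh': "AE s in lborel. h s = h' s"
    using completion_ex_borel_measurable_real[OF h] by auto
  define F where "F x = (LINT s|lborel. indicator {0..x} s * (k' (x, s) * h' s))" for x
  have [measurable]: "k' \<in> borel_measurable (lborel \<Otimes>\<^sub>M lborel)"
    using k' by (simp add: lborel_prod)
  have [measurable]: "(\<lambda>p :: real \<times> real. indicator {0..fst p} (snd p) :: real)
      \<in> borel_measurable (lborel \<Otimes>\<^sub>M lborel)"
  proof -
    have "closed {p :: real \<times> real. 0 \<le> snd p \<and> snd p \<le> fst p}"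
      by (intro closed_Collect_conj closed_Collect_le continuous_intros)
    then have "(indicator {p. 0 \<le> snd p \<and> snd p \<le> fst p} :: real \<times> real \<Rightarrow> real)
        \<in> borel_measurable (lborel \<Otimes>\<^sub>M lborel)"
      unfolding lborel_prod by (intro borel_measurable_indicator) simp
    also have "(indicator {p. 0 \<le> snd p \<and> snd p \<le> fst p} :: real \<times> real \<Rightarrow> real)
        = (\<lambda>p. indicator {0..fst p} (snd p))"
      by (auto simp: indicator_def)
    finally show ?thesis .
  qed
  have "F \<in> borel_measurable lborel"
    unfolding F_def
  proof (rule lborel.borel_measurable_lebesgue_integral)
    show "(\<lambda>(x, s). indicator {0..x} s * (k' (x, s) * h' s)) \<in> borel_measurable (lborel \<Otimes>\<^sub>M lborel)"
      unfolding case_prod_beta by measurable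
  qed
  then have F: "F \<in> borel_measurable lebesgue"
    by (rule measurable_completion)
  have "AE x in lborel. AE s in lborel. k x s = k' (x, s)"
  proof -
    have "AE z in lborel \<Otimes>\<^sub>M lborel. (case z of (x, s) \<Rightarrow> k x s) = k' z"
      unfolding lborel_prod by (rule kk')
    from lborel_pair.AE_pair[OF this] show ?thesis by simp
  qed
  then have "AE x in lborel. F x = (LINT s:{0..x}|lebesgue. k x s * h s)"
  proof eventually_elim
    case (elim x)
    have meas': "(\<lambda>s. indicator {0..x} s * (k' (x, s) * h' s)) \<in> borel_measurable lborel"
      by measurable
    from elim hh' have "AE s in lborel. indicator {0..x} s * (k' (x, s) * h' s)
        = indicator {0..x} s * (k x s * h s)"
      by eventually_elim simp
    then have eq: "AE s in lebesgue. indicator {0..x} s * (k' (x, s) * h' s)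
        = indicator {0..x} s * (k x s * h s)"
      by (rule AE_completion)
    have meas: "(\<lambda>s. indicator {0..x} s * (k x s * h s)) \<in> borel_measurable lebesgue"
      by (rule borel_measurable_AE[OF measurable_completion[OF meas'] eq])
    have "F x = (LINT s|lebesgue. indicator {0..x} s * (k' (x, s) * h' s))"
      unfolding F_def by (rule integral_completion[OF meas', symmetric])
    also have "\<dots> = (LINT s:{0..x}|lebesgue. k x s * h s)"
      unfolding set_lebesgue_integral_def real_scaleR_def
      by (rule integral_cong_AE[OF measurable_completion[OF meas'] meas eq])
    finally show ?case .
  qed
  then show ?thesis
    by (rule borel_measurable_AE[OF F AE_completion])
qed

text \<open>The operator at \<open>x\<close> in \<open>[0, d]\<close> sees its argument on \<open>[0, x]\<close> only, so an
  argument given on \<open>[0, d]\<close> may be extended by \<open>0\<close> to a function that is measurable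
  on the whole line.\<close>

lemma nonlinearity_extension_measurable:
  assumes g: "volterra_nonlinearity g" and f: "admissible_on d f"
  shows "(\<lambda>s. g (if s \<in> {0..d} then f s else 0)) \<in> borel_measurable lebesgue"
proof -
  have "(\<lambda>s. if s \<in> {0..d} then f s else 0) \<in> borel_measurable lebesgue"
    using f by (intro borel_measurable_if_I) (auto simp: admissible_on_def)
  then show ?thesis
    using nonlinearity_measurable[OF g] by (rule measurable_compose)
qed

lemma volterra_op_measurable:
  assumes "general_conditions k g" and f: "admissible_on d f"
  shows "volterra_op k g f \<in> borel_measurable (lebesgue_on {0..d})"
proof -
  let ?h = "\<lambda>s. g (if s \<in> {0..d} then f s else 0)"
  have k: "(\<lambda>(x, s). k x s) \<in> borel_measurable lebesgue" and g: "volterra_nonlinearity g"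
    using assms by (auto simp: general_conditions_def volterra_kernel_def)
  have "(\<lambda>x. LINT s:{0..x}|lebesgue. k x s * ?h s) \<in> borel_measurable (lebesgue_on {0..d})"
    by (intro measurable_restrict_space1 borel_measurable_lebesgue_kernel_integral k
        nonlinearity_extension_measurable[OF g f])
  moreover have "volterra_op k g f x = (LINT s:{0..x}|lebesgue. k x s * ?h s)" if "x \<in> {0..d}" for x
    unfolding volterra_op_def by (rule set_lebesgue_integral_cong) (use that in auto)
  ultimately show ?thesis
    by (subst measurable_cong[of _ _ "\<lambda>x. LINT s:{0..x}|lebesgue. k x s * ?h s"])
       (auto simp: space_restrict_space)
qed

section \<open>The Volterra operator as a monotone map\<close>

text \<open>Joint measurability of the kernel says nothing about an individual section \<open>k x\<close>; its
  measurability is part of its local integrability.\<close>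

lemma volterra_integrand_measurable:
  assumes "general_conditions k g" and f: "admissible_on d f" and x: "x \<in> {0..d}"
  shows "set_borel_measurable lebesgue {0..x} (\<lambda>s. k x s * g (f s))"
proof -
  let ?h = "\<lambda>s. g (if s \<in> {0..d} then f s else 0)"
  have "set_integrable lebesgue {0..x} (k x)" and g: "volterra_nonlinearity g"
    using assms by (auto simp: general_conditions_def volterra_kernel_def)
  then have "(\<lambda>s. (indicator {0..x} s *\<^sub>R k x s) * ?h s) \<in> borel_measurable lebesgue"
    using nonlinearity_extension_measurable[OF g f]
    by (intro borel_measurable_times) (auto simp: set_integrable_def)
  also have "(\<lambda>s. (indicator {0..x} s *\<^sub>R k x s) * ?h s)
      = (\<lambda>s. indicator {0..x} s *\<^sub>R (k x s * g (f s)))"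
    using x by (auto simp: indicator_def)
  finally show ?thesis
    unfolding set_borel_measurable_def .
qed

lemma volterra_integrand_bound:
  assumes "general_conditions k g" and "y \<le> B"
  shows "norm (k x s * g y) \<le> k x s * g B"
proof -
  have g: "volterra_nonlinearity g" and "0 \<le> k x s"
    using assms by (auto simp: general_conditions_def volterra_kernel_def)
  then show ?thesis
    using monoD[OF nonlinearity_mono[OF g] assms(2)] nonlinearity_nonneg[OF g, of y]
    by (auto simp: abs_mult intro: mult_left_mono)
qed

lemma kernel_dominant_integrable:
  assumes "general_conditions k g"
  shows "set_integrable lebesgue {0..x} (\<lambda>s. k x s * c)"
  using assms by (auto simp: general_conditions_def volterra_kernel_def)

lemma volterra_integrand_integrable:
  assumes "general_conditions k g" and f: "admissible_on d f" and x: "x \<in> {0..d}"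
  shows "set_integrable lebesgue {0..x} (\<lambda>s. k x s * g (f s))"
proof -
  obtain B where B: "\<And>s. s \<in> {0..d} \<Longrightarrow> f s \<le> B"
    using admissible_on_bounded_above[OF f] by blast
  show ?thesis
  proof (rule set_integrable_bound)
    show "set_integrable lebesgue {0..x} (\<lambda>s. k x s * g B)"
      by (rule kernel_dominant_integrable[OF assms(1)])
    show "AE s in lebesgue. s \<in> {0..x} \<longrightarrow> norm (k x s * g (f s)) \<le> norm (k x s * g B)"
      using x by (intro AE_I2 impI order_trans[OF volterra_integrand_bound[OF assms(1) B]]) auto
  qed (rule volterra_integrand_measurable[OF assms])
qed

lemma volterra_op_mono:
  assumes "general_conditions k g" and "admissible_on d f" "admissible_on d h"
    and le: "\<And>s. s \<in> {0..d} \<Longrightarrow> f s \<le> h s" and x: "x \<in> {0..d}"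
  shows "volterra_op k g f x \<le> volterra_op k g h x"
  unfolding volterra_op_def
proof (rule set_integral_mono)
  fix s assume "s \<in> {0..x}"
  then have "f s \<le> h s" using x le by auto
  moreover have "mono g" "0 \<le> k x s"
    using assms(1) nonlinearity_mono by (auto simp: general_conditions_def volterra_kernel_def)
  ultimately show "k x s * g (f s) \<le> k x s * g (h s)"
    by (intro mult_left_mono) (auto dest: monoD)
qed (use assms volterra_integrand_integrable in blast)+

lemma volterra_op_nonneg:
  assumes "general_conditions k g"
  shows "0 \<le> volterra_op k g f x"
  using assms nonlinearity_nonneg
  unfolding volterra_op_def set_lebesgue_integral_def
  by (intro integral_nonneg_AE AE_I2) (auto simp: general_conditions_def volterra_kernel_def)

lemma volterra_op_tendsto:
  assumes GC: "general_conditions k g"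
    and f: "\<And>n. admissible_on d (f n)" and h: "admissible_on d h"
    and le: "\<And>n s. s \<in> {0..d} \<Longrightarrow> f n s \<le> B"
    and lim: "\<And>s. s \<in> {0..d} \<Longrightarrow> (\<lambda>n. f n s) \<longlonglongrightarrow> h s"
    and x: "x \<in> {0..d}"
  shows "(\<lambda>n. volterra_op k g (f n) x) \<longlonglongrightarrow> volterra_op k g h x"
  unfolding volterra_op_def set_lebesgue_integral_def
proof (rule integral_dominated_convergence)
  show "integrable lebesgue (\<lambda>s. indicator {0..x} s *\<^sub>R (k x s * g B))"
    using kernel_dominant_integrable[OF GC] unfolding set_integrable_def .
  show "AE s in lebesgue. (\<lambda>n. indicator {0..x} s *\<^sub>R (k x s * g (f n s)))
      \<longlonglongrightarrow> indicator {0..x} s *\<^sub>R (k x s * g (h s))"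
  proof (rule AE_I2)
    fix s
    have "isCont g (h s)"
      using GC by (auto simp: general_conditions_def volterra_nonlinearity_def
          continuous_on_eq_continuous_at)
    then have "(\<lambda>n. g (f n s)) \<longlonglongrightarrow> g (h s)" if "s \<in> {0..x}"
      using lim[of s] x that by (intro isCont_tendsto_compose[of _ g]) auto
    then show "(\<lambda>n. indicator {0..x} s *\<^sub>R (k x s * g (f n s)))
        \<longlonglongrightarrow> indicator {0..x} s *\<^sub>R (k x s * g (h s))"
      by (cases "s \<in> {0..x}") (auto intro!: tendsto_intros)
  qed
  show "AE s in lebesgue. norm (indicator {0..x} s *\<^sub>R (k x s * g (f n s)))
      \<le> indicator {0..x} s *\<^sub>R (k x s * g B)" for n
  proof (rule AE_I2)
    fix s show "norm (indicator {0..x} s *\<^sub>R (k x s * g (f n s)))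
        \<le> indicator {0..x} s *\<^sub>R (k x s * g B)"
      using volterra_integrand_bound[OF GC le[of s n], of x] x by (cases "s \<in> {0..x}") auto
  qed
qed (use volterra_integrand_measurable[OF GC] f h x in \<open>auto simp: set_borel_measurable_def\<close>)

section \<open>Monotone iteration\<close>

text \<open>The iterates of the operator on \<open>v\<close> increase pointwise and stay below
  \<open>w\<close>, and dominated convergence carries the equation to their limit.\<close>

lemma solution_between_sub_and_supersolution:
  assumes GC: "general_conditions k g" and v: "subsolution_on k g d v"
    and w: "admissible_on d w" and super: "\<And>x. x \<in> {0..d} \<Longrightarrow> volterra_op k g w x \<le> w x"
    and vw: "\<And>x. x \<in> {0..d} \<Longrightarrow> v x \<le> w x"
  obtains u where "solution_on k g d u"
    and "\<And>x. x \<in> {0..d} \<Longrightarrow> v x \<le> u x" and "\<And>x. x \<in> {0..d} \<Longrightarrow> u x \<le> w x"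
proof -
  define U where "U n = (volterra_op k g ^^ n) v" for n
  have U_0: "U 0 = v" and U_Suc: "U (Suc n) = volterra_op k g (U n)" for n
    by (auto simp: U_def)
  obtain B where B: "\<And>s. s \<in> {0..d} \<Longrightarrow> w s \<le> B"
    using admissible_on_bounded_above[OF w] by blast
  have admI: "admissible_on d f"
    if "f \<in> borel_measurable (lebesgue_on {0..d})" and f0: "\<And>x. x \<in> {0..d} \<Longrightarrow> 0 \<le> f x"
      and fw: "\<And>x. x \<in> {0..d} \<Longrightarrow> f x \<le> w x" for f
  proof -
    have "norm (f x) \<le> B" if "x \<in> {0..d}" for x
      using f0[OF that] fw[OF that] B[OF that] by simp
    then have "bounded (f ` {0..d})"
      by (intro boundedI[of _ B]) auto
    with that(1) f0 show ?thesis
      unfolding admissible_on_def by blast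
  qed
  have U: "admissible_on d (U n) \<and> (\<forall>x\<in>{0..d}. U n x \<le> w x)" for n
  proof (induction n)
    case 0 then show ?case
      using v vw by (auto simp: U_0 subsolution_on_def)
  next
    case (Suc n)
    have "volterra_op k g (U n) x \<le> w x" if "x \<in> {0..d}" for x
      using volterra_op_mono[OF GC _ w _ that] Suc super[OF that] by (meson order_trans)
    then show ?case
      using Suc by (auto simp: U_Suc intro!: admI volterra_op_measurable[OF GC] volterra_op_nonneg[OF GC])
  qed
  have step: "U n x \<le> U (Suc n) x" if "x \<in> {0..d}" for n x
    using that
  proof (induction n arbitrary: x)
    case 0 then show ?case
      using v by (auto simp: U_0 U_Suc subsolution_on_def)
  next
    case (Suc n) show ?case
      using volterra_op_mono[OF GC conjunct1[OF U] conjunct1[OF U] Suc.IH Suc.prems]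
      by (simp only: U_Suc)
  qed
  have inc: "incseq (\<lambda>n. U n x)" if "x \<in> {0..d}" for x
    by (rule incseq_SucI) (rule step[OF that])
  define u where "u x = lim (\<lambda>n. U n x)" for x
  have lim: "(\<lambda>n. U n x) \<longlonglongrightarrow> u x" if x: "x \<in> {0..d}" for x
  proof -
    obtain L where "(\<lambda>n. U n x) \<longlonglongrightarrow> L"
      using incseq_convergent[OF inc[OF x], of "w x"] U x by blast
    then show ?thesis by (simp add: u_def limI)
  qed
  have vu: "v x \<le> u x" if "x \<in> {0..d}" for x
    using incseq_le[OF inc[OF that] lim[OF that], of 0] by (simp add: U_0)
  have uw: "u x \<le> w x" if "x \<in> {0..d}" for x
    using LIMSEQ_le_const2[OF lim[OF that], of "w x"] U that by blast
  have u: "admissible_on d u"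
  proof (rule admI[OF _ _ uw])
    show "u \<in> borel_measurable (lebesgue_on {0..d})"
    proof (rule borel_measurable_LIMSEQ_real[where u = U])
      show "U n \<in> borel_measurable (lebesgue_on {0..d})" for n
        using U by (auto simp: admissible_on_def)
    qed (use lim in \<open>auto simp: space_restrict_space\<close>)
    show "0 \<le> u x" if "x \<in> {0..d}" for x
    proof -
      have "0 \<le> v x"
        using v that by (simp add: subsolution_on_def admissible_on_def)
      then show ?thesis using vu[OF that] by simp
    qed
  qed
  have "u x = volterra_op k g u x" if "x \<in> {0..d}" for x
  proof (rule LIMSEQ_unique)
    show "(\<lambda>n. U (Suc n) x) \<longlonglongrightarrow> u x"
      using lim[OF that] by (rule LIMSEQ_Suc)
    have "U n s \<le> B" if "s \<in> {0..d}" for n s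
      using U B that by (meson order_trans)
    then show "(\<lambda>n. U (Suc n) x) \<longlonglongrightarrow> volterra_op k g u x"
      unfolding U_Suc using U u lim that by (intro volterra_op_tendsto[OF GC]) auto
  qed
  with u have "solution_on k g d u"
    by (auto simp: solution_on_def)
  then show ?thesis
    using vu uw by (rule that)
qed

section \<open>A supersolution starting at an arbitrary point\<close>

text \<open>Since \<open>g 0 = 0\<close>, only the part \<open>[a, x]\<close> of the past contributes to the
  operator at \<open>x\<close>, so the value there is at most \<open>C * g M * (x - a)\<close>. This is where the local boundedness of the kernel
  enters.\<close>

lemma step_function_is_supersolution:
  assumes GC: "general_conditions k g" and a: "0 \<le> a" "a \<le> d" and M: "0 \<le> M"
    and C: "\<And>x s. x \<in> {0..d} \<Longrightarrow> s \<in> {0..d} \<Longrightarrow> k x s \<le> C"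
    and short: "C * g M * (d - a) \<le> M"
  defines "w \<equiv> \<lambda>x. if x \<le> a then 0 else M"
  shows "admissible_on d w" and "\<And>x. x \<in> {0..d} \<Longrightarrow> volterra_op k g w x \<le> w x"
proof -
  have g: "volterra_nonlinearity g" and k: "0 \<le> k x s" for x s
    using GC by (auto simp: general_conditions_def volterra_kernel_def)
  show w: "admissible_on d w"
    using M unfolding admissible_on_def w_def bounded_iff
    by (auto intro!: exI[of _ M] measurable_restrict_space1 measurable_completion)
  fix x assume x: "x \<in> {0..d}"
  have C0: "0 \<le> C"
    using C[of x x] k[of x x] x by auto
  have le: "k x s * g (w s) \<le> C * g M * indicator {a<..} s" if "s \<in> {0..x}" for s
    using that C[of x s] x nonlinearity_nonneg[OF g, of M] nonlinearity_at_0[OF g]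
    by (auto simp: w_def intro: mult_right_mono)
  have int: "set_integrable lebesgue {0..x} (\<lambda>s. C * g M * indicator {a<..} s)"
  proof -
    have "emeasure lborel {a<..x} < \<infinity>"
      by (cases "a \<le> x") auto
    then have "integrable lebesgue (\<lambda>s. C * g M * indicator {a<..x} s)"
      by (intro integrable_mult_right integrable_real_indicator) auto
    also have "(\<lambda>s. C * g M * indicator {a<..x} s)
        = (\<lambda>s. indicator {0..x} s *\<^sub>R (C * g M * indicator {a<..} s))"
      using a by (auto simp: indicator_def)
    finally show ?thesis
      unfolding set_integrable_def .
  qed
  have "volterra_op k g w x \<le> (LINT s:{0..x}|lebesgue. C * g M * indicator {a<..} s)"
    unfolding volterra_op_def
    by (rule set_integral_mono[OF volterra_integrand_integrable[OF GC w x] int le])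
  also have "\<dots> = (LINT s|lebesgue. C * g M * indicator {a<..x} s)"
    unfolding set_lebesgue_integral_def
    by (rule Bochner_Integration.integral_cong) (use a in \<open>auto simp: indicator_def\<close>)
  also have "\<dots> = C * g M * max 0 (x - a)"
    by (auto simp: max_def measure_completion)
  also have "\<dots> \<le> w x"
  proof (cases "x \<le> a")
    case False
    have "C * g M * (x - a) \<le> C * g M * (d - a)"
      using x C0 nonlinearity_nonneg[OF g] by (intro mult_left_mono) auto
    with False short show ?thesis by (simp add: w_def)
  qed (simp add: w_def)
  finally show "volterra_op k g w x \<le> w x" .
qed

lemma subsolution_on_subinterval:
  assumes "subsolution_on k g d v" "d' \<le> d"
  shows "subsolution_on k g d' v"
proof -
  have sub: "{0..d'} \<subseteq> {0..d}" using assms by auto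
  have v: "v \<in> borel_measurable (lebesgue_on {0..d})" "bounded (v ` {0..d})"
      "\<forall>x\<in>{0..d}. 0 \<le> v x \<and> v x \<le> volterra_op k g v x"
    using assms(1) by (auto simp: subsolution_on_def admissible_on_def)
  have "v \<in> borel_measurable (lebesgue_on {0..d'})"
    using v(1) sub by (rule measurable_restrict_mono)
  moreover have "bounded (v ` {0..d'})"
    using v(2) image_mono[OF sub] by (rule bounded_subset)
  moreover have "\<forall>x\<in>{0..d'}. 0 \<le> v x \<and> v x \<le> volterra_op k g v x"
    using v(3) sub by blast
  ultimately show ?thesis
    unfolding subsolution_on_def admissible_on_def by blast
qed

text \<open>At the endpoint of its initial zero interval a subsolution vanishes too, although it need
  not be continuous: the integrand of the operator is \<open>0\<close> there except possibly at
  the endpoint, which is a null set.\<close>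

lemma subsolution_onset:
  assumes GC: "general_conditions k g" and v: "subsolution_on k g d v" and nt: "nontrivial_on d v"
  obtains a where "0 \<le> a" "a < d" "\<And>x. x \<in> {0..a} \<Longrightarrow> v x = 0"
    and "\<And>d'. a < d' \<Longrightarrow> d' \<le> d \<Longrightarrow> nontrivial_on d' v"
proof -
  have g0: "g 0 = 0"
    using GC nonlinearity_at_0 by (auto simp: general_conditions_def)
  have vpos: "0 \<le> v x" "v x \<le> volterra_op k g v x" if "x \<in> {0..d}" for x
    using v that by (auto simp: subsolution_on_def admissible_on_def)
  have close: "v x = 0" if x: "x \<in> {0..d}" and z: "\<And>s. 0 \<le> s \<Longrightarrow> s < x \<Longrightarrow> v s = 0" for x
  proof -
    have "volterra_op k g v x = (LINT s :: real|lebesgue. 0)"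
      unfolding volterra_op_def set_lebesgue_integral_def
    proof (rule integral_cong_AE)
      have "AE s in lborel. s \<noteq> x" by (rule AE_lborel_singleton)
      then have "AE s in lebesgue. s \<noteq> x" by (rule AE_completion)
      then show "AE s in lebesgue. indicator {0..x} s *\<^sub>R (k x s * g (v s)) = 0"
        by eventually_elim (auto simp: indicator_def z g0)
      show "(\<lambda>s. indicator {0..x} s *\<^sub>R (k x s * g (v s))) \<in> borel_measurable lebesgue"
        using volterra_integrand_measurable[OF GC _ x, of v] v
        by (auto simp: subsolution_on_def set_borel_measurable_def)
    qed simp
    then show ?thesis using vpos[OF x] by simp
  qed
  obtain y where y: "y \<in> {0..d}" "v y \<noteq> 0"
    using nt by (auto simp: nontrivial_on_def)
  define P where "P = {x \<in> {0..d}. v x \<noteq> 0}"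
  define a where "a = Inf P"
  have "P \<noteq> {}" and bdd: "bdd_below P"
    using y by (auto simp: P_def intro!: bdd_belowI[of _ 0])
  then have a0: "0 \<le> a"
    unfolding a_def by (intro cInf_greatest) (auto simp: P_def)
  have below: "v s = 0" if "0 \<le> s" "s < a" "s \<le> d" for s
    using cInf_lower[OF _ bdd, of s] that by (auto simp: a_def P_def)
  have "a \<le> d"
    using cInf_lower[OF _ bdd, of y] y by (auto simp: a_def P_def)
  have va: "v a = 0"
  proof (rule close)
    show "a \<in> {0..d}"
      using a0 \<open>a \<le> d\<close> by simp
    show "v s = 0" if "0 \<le> s" "s < a" for s
      using below that \<open>a \<le> d\<close> by simp
  qed
  have "a < y"
    using cInf_lower[OF _ bdd, of y] y va by (cases "a = y") (auto simp: a_def P_def)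
  then have "a < d" using y by auto
  moreover have "v x = 0" if "x \<in> {0..a}" for x
    using that below va \<open>a \<le> d\<close> by (cases "x = a") auto
  moreover have "nontrivial_on d' v" if "a < d'" "d' \<le> d" for d'
  proof -
    obtain x where "x \<in> P" "x < d'"
      using cInf_lessD[OF \<open>P \<noteq> {}\<close>, of d'] \<open>a < d'\<close> by (auto simp: a_def)
    then show ?thesis
      unfolding nontrivial_on_def P_def by (intro bexI[of _ x]) auto
  qed
  ultimately show ?thesis
    using a0 by (intro that) auto
qed

section \<open>Nontrivial solutions and nontrivial subsolutions\<close>

theorem theorem3:
  fixes k :: "real \<Rightarrow> real \<Rightarrow> real" and g :: "real \<Rightarrow> real"
  assumes "general_conditions k g"
  shows "(\<exists>\<delta>>0. \<exists>u. solution_on k g \<delta> u \<and> nontrivial_on \<delta> u) \<longleftrightarrow>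
         (\<exists>\<delta>>0. \<exists>v. subsolution_on k g \<delta> v \<and> nontrivial_on \<delta> v)"
proof
  assume "\<exists>\<delta>>0. \<exists>u. solution_on k g \<delta> u \<and> nontrivial_on \<delta> u"
  then show "\<exists>\<delta>>0. \<exists>v. subsolution_on k g \<delta> v \<and> nontrivial_on \<delta> v"
    unfolding solution_on_def subsolution_on_def by (metis order_refl)
next
  assume "\<exists>\<delta>>0. \<exists>v. subsolution_on k g \<delta> v \<and> nontrivial_on \<delta> v"
  then obtain \<delta> v where v: "subsolution_on k g \<delta> v" "nontrivial_on \<delta> v"
    by blast
  obtain a where a: "0 \<le> a" "a < \<delta>" "\<And>x. x \<in> {0..a} \<Longrightarrow> v x = 0"
      and onset: "\<And>d. a < d \<Longrightarrow> d \<le> \<delta> \<Longrightarrow> nontrivial_on d v"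
    using subsolution_onset[OF assms v] by blast
  obtain M where M: "0 < M" "\<And>x. x \<in> {0..\<delta>} \<Longrightarrow> v x \<le> M"
    using v(1) admissible_on_bounded_above unfolding subsolution_on_def by blast
  obtain C where C: "0 < C" "\<And>x s. x \<in> {0..\<delta>} \<Longrightarrow> s \<in> {0..\<delta>} \<Longrightarrow> k x s \<le> C"
  proof -
    have "compact ({0..\<delta>} \<times> {0..\<delta>})"
      by (intro compact_Times compact_Icc)
    then have "bounded ((\<lambda>(x, s). k x s) ` ({0..\<delta>} \<times> {0..\<delta>}))"
      using assms unfolding general_conditions_def volterra_kernel_def by blast
    then obtain C where "0 < C" and C: "\<forall>z\<in>(\<lambda>(x, s). k x s) ` ({0..\<delta>} \<times> {0..\<delta>}). norm z \<le> C"
      unfolding bounded_pos by blast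
    have "k x s \<le> C" if "x \<in> {0..\<delta>}" "s \<in> {0..\<delta>}" for x s
      using bspec[OF C imageI[OF SigmaI[OF that]]] by simp
    with \<open>0 < C\<close> show ?thesis by (rule that)
  qed
  have gM: "0 \<le> g M"
    using assms nonlinearity_nonneg by (auto simp: general_conditions_def)
  \<comment> \<open>The summand 1 keeps the denominator positive.\<close>
  define h where "h = M / (C * g M + 1)"
  define d where "d = min \<delta> (a + h)"
  have pos: "0 < C * g M + 1"
    using C(1) gM by (simp add: add_nonneg_pos)
  have d: "a < d" "d \<le> \<delta>"
    using a M(1) pos by (auto simp: d_def h_def)
  have "C * g M * (d - a) \<le> (C * g M + 1) * h"
    using C(1) gM d by (intro mult_mono) (auto simp: d_def)
  also have "\<dots> = M"
    using pos by (simp add: h_def)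
  finally have short: "C * g M * (d - a) \<le> M" .
  define w where "w = (\<lambda>x. if x \<le> a then 0 else M)"
  have w: "admissible_on d w" "\<And>x. x \<in> {0..d} \<Longrightarrow> volterra_op k g w x \<le> w x"
    using step_function_is_supersolution[OF assms, of a d M C] a(1) d M(1) C short
    by (auto simp: w_def)
  have "v x \<le> w x" if "x \<in> {0..d}" for x
    using that a(3)[of x] M(2)[of x] d by (auto simp: w_def)
  then obtain u where u: "solution_on k g d u" "\<And>x. x \<in> {0..d} \<Longrightarrow> v x \<le> u x"
    using solution_between_sub_and_supersolution[OF assms subsolution_on_subinterval[OF v(1) d(2)] w]
    by blast
  obtain x where x: "x \<in> {0..d}" "v x \<noteq> 0"
    using onset[OF d] by (auto simp: nontrivial_on_def)
  moreover have "0 \<le> v x"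
    using v(1) x d(2) by (auto simp: subsolution_on_def admissible_on_def)
  ultimately have "u x \<noteq> 0"
    using u(2)[of x] by auto
  then have "nontrivial_on d u"
    using x by (auto simp: nontrivial_on_def)
  then show "\<exists>\<delta>>0. \<exists>u. solution_on k g \<delta> u \<and> nontrivial_on \<delta> u"
    using u(1) a(1) d(1) by (intro exI[of _ d]) auto
qed

end
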